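(* The class of diagram groups is closed under countable direct powers; that is, if $G$ is a diagram group, then the countable direct power of $G$ is also a diagram group.
   Context: The countable direct power of $G$ means the restricted direct product (direct sum) of countably infinitely many copies of $G$. Diagram groups. A semigroup presentation $\mathcal{P}=\langle\Sigma\mid\mathcal{R}\rangle$ consists of an alphabet $\Sigma$ and a set $\mathcal{R}$ of pairs $(u,v)$ of non-empty words over $\Sigma$, written $u=v$; presentations are assumed anti-symmetric: if $(u=v)\in\mathcal{R}$ then $(v=u)\notin\mathcal{R}$. $\Sigma^+$ and $\Sigma^*$ are the free semigroup and free monoid on $\Sigma$. The graph $\Gamma(\mathcal{P})$ has vertex set $\Sigma^+$ and an edge $(p,u\to v,q)$ from $puq$ to $pvq$ for all $p,q\in\Sigma^*$ and all $u,v$ with $(u=v)\in\mathcal{R}$ or $(v=u)\in\mathcal{R}$; the inverse edge is $(p,v\to u,q)$. The Squier complex $\mathcal{K}(\mathcal{P})$ is the 2-complex obtained from $\Gamma(\mathcal{P})$ by attaching, for all $p,z,q\in\Sigma^*$ and $(\ell_1=r_1),(\ell_2=r_2)\in\mathcal{R}$, a 2-cell along the closed path $p_1p_2^{-1}$, where $p_1=(p,\ell_1\to r_1,z\ell_2q)(pr_1z,\ell_2\to r_2,q)$ and $p_2=(p\ell_1z,\ell_2\to r_2,q)(p,\ell_1\to r_1,zr_2q)$. For $w\in\Sigma^+$ the diagram group $\mathcal{D}(\mathcal{P},w)$ is (up to isomorphism, by Kilibarda's theorem; this may be taken as the definition) the fundamental group $\pi_1(\mathcal{K}(\mathcal{P}),w)$.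 A group is a diagram group if it is isomorphic to some $\mathcal{D}(\mathcal{P},w)$. *)

theory Defs
  imports "HOL-Algebra.Product_Groups"
begin

section \<open>Combinatorial 2-complexes and their fundamental groups\<close>

text \<open>Graphs are oriented in the sense of Serre: the edge set is closed under the inversion map.
  2-cells are given by their boundaries, closed edge paths. An edge path is a list of edges
  together with its end points, so the empty list is the constant path at any vertex.\<close>

record ('v, 'e) complex2 =
  vertices :: "'v set"
  edges :: "'e set"
  source :: "'e \<Rightarrow> 'v"
  target :: "'e \<Rightarrow> 'v"
  inv_edge :: "'e \<Rightarrow> 'e"
  boundaries :: "'e list set"

fun is_path :: "('v, 'e, 'm) complex2_scheme \<Rightarrow> 'v \<Rightarrow> 'e list \<Rightarrow> 'v \<Rightarrow> bool" where
  "is_path C x [] y \<longleftrightarrow> x \<in> vertices C \<and> x = y"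
| "is_path C x (e # es) y \<longleftrightarrow>
     x \<in> vertices C \<and> e \<in> edges C \<and> source C e = x \<and> is_path C (target C e) es y"

definition inv_path :: "('v, 'e, 'm) complex2_scheme \<Rightarrow> 'e list \<Rightarrow> 'e list" where
  "inv_path C es = map (inv_edge C) (rev es)"

inductive homotopic ::
  "('v, 'e, 'm) complex2_scheme \<Rightarrow> 'v \<Rightarrow> 'v \<Rightarrow> 'e list \<Rightarrow> 'e list \<Rightarrow> bool"
  for C :: "('v, 'e, 'm) complex2_scheme" and x y :: 'v where
  refl: "is_path C x as y \<Longrightarrow> homotopic C x y as as"
| sym: "homotopic C x y as bs \<Longrightarrow> homotopic C x y bs as"
| trans: "homotopic C x y as bs \<Longrightarrow> homotopic C x y bs cs \<Longrightarrow> homotopic C x y as cs"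
| backtrack: "is_path C x (as @ bs) y \<Longrightarrow> is_path C x (as @ [e, inv_edge C e] @ bs) y \<Longrightarrow>
    homotopic C x y (as @ [e, inv_edge C e] @ bs) (as @ bs)"
| cell: "c \<in> boundaries C \<Longrightarrow> is_path C x (as @ bs) y \<Longrightarrow> is_path C x (as @ c @ bs) y \<Longrightarrow>
    homotopic C x y (as @ c @ bs) (as @ bs)"

definition loops :: "('v, 'e, 'm) complex2_scheme \<Rightarrow> 'v \<Rightarrow> 'e list set" where
  "loops C x = {es. is_path C x es x}"

definition loop_homotopy :: "('v, 'e, 'm) complex2_scheme \<Rightarrow> 'v \<Rightarrow> 'e list rel" where
  "loop_homotopy C x = {(as, bs). homotopic C x x as bs}"

definition fundamental_group ::
  "('v, 'e, 'm) complex2_scheme \<Rightarrow> 'v \<Rightarrow> 'e list set monoid" where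
  "fundamental_group C x = \<lparr>
     carrier = loops C x // loop_homotopy C x,
     monoid.mult = (\<lambda>X Y. \<Union>as\<in>X. \<Union>bs\<in>Y. loop_homotopy C x `` {as @ bs}),
     one = loop_homotopy C x `` {[]}\<rparr>"


section \<open>Semigroup presentations and Squier complexes\<close>

record 'a presentation =
  letters :: "'a set"
  relations :: "('a list \<times> 'a list) set"

definition nonempty_words :: "'a presentation \<Rightarrow> 'a list set" where
  "nonempty_words P = lists (letters P) - {[]}"

definition semigroup_presentation :: "'a presentation \<Rightarrow> bool" where
  "semigroup_presentation P \<longleftrightarrow>
     relations P \<subseteq> nonempty_words P \<times> nonempty_words P \<and> asym (relations P)"

text \<open>The tuple \<open>(p, u, v, q)\<close> is the edge from \<open>puq\<close> to \<open>pvq\<close>.\<close>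

type_synonym 'a squier_edge = "'a list \<times> 'a list \<times> 'a list \<times> 'a list"

definition squier_graph :: "'a presentation \<Rightarrow> ('a list, 'a squier_edge) complex2" where
  "squier_graph P = \<lparr>
     vertices = nonempty_words P,
     edges = {(p, u, v, q) | p u v q. p \<in> lists (letters P) \<and> q \<in> lists (letters P) \<and>
                ((u, v) \<in> relations P \<or> (v, u) \<in> relations P)},
     source = (\<lambda>(p, u, v, q). p @ u @ q),
     target = (\<lambda>(p, u, v, q). p @ v @ q),
     inv_edge = (\<lambda>(p, u, v, q). (p, v, u, q)),
     boundaries = {}\<rparr>"

definition squier_complex :: "'a presentation \<Rightarrow> ('a list, 'a squier_edge) complex2" where
  "squier_complex P = (squier_graph P)\<lparr>boundaries :=
     {[(p, l1, r1, z @ l2 @ q), (p @ r1 @ z, l2, r2, q)] @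
      inv_path (squier_graph P) [(p @ l1 @ z, l2, r2, q), (p, l1, r1, z @ r2 @ q)]
      | p z q l1 r1 l2 r2.
        p \<in> lists (letters P) \<and> z \<in> lists (letters P) \<and> q \<in> lists (letters P) \<and>
        (l1, r1) \<in> relations P \<and> (l2, r2) \<in> relations P}\<rparr>"


section \<open>Diagram groups\<close>

definition diagram_group_of :: "'a presentation \<Rightarrow> 'a list \<Rightarrow> 'a squier_edge list set monoid" where
  "diagram_group_of P w = fundamental_group (squier_complex P) w"

text \<open>The first argument records the type from which the letters of the alphabet are drawn; the
  alphabet itself is an arbitrary set of such letters. HOL cannot quantify over types inside a
  formula, so the class of all diagram groups is the union of these predicates over all types.\<close>

definition is_diagram_group :: "'a itself \<Rightarrow> ('g, 'm) monoid_scheme \<Rightarrow> bool" where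
  "is_diagram_group (_ :: 'a itself) G \<longleftrightarrow> group G \<and>
     (\<exists>(P :: 'a presentation) w. semigroup_presentation P \<and> w \<in> nonempty_words P \<and>
        G \<cong> diagram_group_of P w)"

definition countable_direct_power :: "('g, 'm) monoid_scheme \<Rightarrow> (nat \<Rightarrow> 'g) monoid" where
  "countable_direct_power G = sum_group (UNIV :: nat set) (\<lambda>_. G)"

end

theory Submission
  imports Defs
begin

text \<open>Let \<open>G\<close> be the fundamental group at \<open>w\<close> of the Squier complex \<open>K\<close> of \<open>P\<close>. Add to \<open>P\<close> two brackets, a
  letter \<open>x\<close> called the reservoir, and the single relation \<open>x = (w)x\<close>; let \<open>L\<close> be the Squier complex
  of the result. Starting from \<open>x\<close> one only meets words \<open>(v\<^sub>1)(v\<^sub>2)\<dots>(v\<^sub>n)x\<close> with all \<open>v\<^sub>i\<close> in the component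
  of \<open>w\<close>. The words with \<open>n\<close> blocks span a copy of (the 2-dimensional part of) the \<open>n\<close>-th power of
  that component of \<open>K\<close>, and the new relation connects it to the next power by
  \<open>(v\<^sub>1, \<dots>, v\<^sub>n) \<mapsto> (v\<^sub>1, \<dots>, v\<^sub>n, w)\<close>. So the component of \<open>x\<close> is a telescope of powers, and its
  fundamental group is the union of \<open>G \<subseteq> G\<^sup>2 \<subseteq> G\<^sup>3 \<subseteq> \<dots>\<close>, which is the countable direct power.
  The brackets keep the blocks from interacting; without them, powers of \<open>w\<close> would occur, at which
  the fundamental group of \<open>K\<close> can be larger than the corresponding power of \<open>G\<close>.

  The proof avoids direct limits by a recursion: a state is either \<open>x\<close> or \<open>(v)r\<close> with another
  state \<open>r\<close>. Reading \<open>x\<close> as \<open>(w)x\<close>, every path of states projects to a path of first factors in \<open>K\<close> and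
  to a path of remaining states in \<open>L\<close>. Both projections respect homotopy (\<open>state_cell_null\<close>), and
  iterating them yields the homomorphism \<open>factors\<close> from the loops at \<open>x\<close> to sequences in \<open>G\<close>.

  Injectivity rests on \<open>path_splits\<close>: edges of different factors commute, so a path can be recovered
  up to homotopy from its two projections. A loop at \<open>x\<close> begins with the expansion of \<open>x\<close>, which
  the second projection forgets; hence that projection shortens loops, which provides both the
  induction for injectivity (\<open>null_homotopic_of_factors\<close>) and the finiteness of the support. For
  surjectivity, \<open>assemble\<close> realises any finite list of loops at \<open>w\<close> as factors of one loop.\<close>

section \<open>Edge paths up to homotopy\<close>

text \<open>Serre's axioms for the inversion of edges. They are what turns homotopy classes of edge paths
  into a groupoid; the definition of a complex alone does not impose them.\<close>

locale serre_complex =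
  fixes C :: "('v, 'e, 'm) complex2_scheme"
  assumes inv_edge_closed: "e \<in> edges C \<Longrightarrow> inv_edge C e \<in> edges C"
    and source_inv_edge: "e \<in> edges C \<Longrightarrow> source C (inv_edge C e) = target C e"
    and target_inv_edge: "e \<in> edges C \<Longrightarrow> target C (inv_edge C e) = source C e"
    and inv_edge_involution: "e \<in> edges C \<Longrightarrow> inv_edge C (inv_edge C e) = e"
    and target_in_vertices: "e \<in> edges C \<Longrightarrow> target C e \<in> vertices C"

lemma is_path_source: "is_path C x es y \<Longrightarrow> x \<in> vertices C"
  by (cases es) auto

lemma is_path_target: "is_path C x es y \<Longrightarrow> y \<in> vertices C"
  by (induction es arbitrary: x) auto

lemma is_path_append:
  "is_path C x (as @ bs) y \<longleftrightarrow> (\<exists>z. is_path C x as z \<and> is_path C z bs y)"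
  by (induction as arbitrary: x) (auto dest: is_path_source)

lemma is_path_appendI: "is_path C x as y \<Longrightarrow> is_path C y bs z \<Longrightarrow> is_path C x (as @ bs) z"
  by (auto simp: is_path_append)

lemma is_path_end_unique: "is_path C x es y \<Longrightarrow> is_path C x es z \<Longrightarrow> y = z"
  by (induction es arbitrary: x) auto

lemma homotopic_imp_paths:
  "homotopic C x y as bs \<Longrightarrow> is_path C x as y \<and> is_path C x bs y"
  by (induction rule: homotopic.induct) auto

lemma homotopic_extend:
  assumes "homotopic C y z as bs" and ps: "is_path C x ps y" and qs: "is_path C z qs u"
  shows "homotopic C x u (ps @ as @ qs) (ps @ bs @ qs)"
  using assms(1)
proof (induction rule: homotopic.induct)
  case (backtrack as bs e)
  have "homotopic C x u ((ps @ as) @ [e, inv_edge C e] @ (bs @ qs)) ((ps @ as) @ (bs @ qs))"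
    using backtrack ps qs by (intro homotopic.backtrack) (auto simp: is_path_append)
  then show ?case by simp
next
  case (cell c as bs)
  have "homotopic C x u ((ps @ as) @ c @ (bs @ qs)) ((ps @ as) @ (bs @ qs))"
    using cell ps qs by (intro homotopic.cell) (auto simp: is_path_append)
  then show ?case by simp
qed (use ps qs in \<open>auto intro: homotopic.intros is_path_appendI\<close>)

lemma homotopic_append:
  assumes "homotopic C x y as as'" "homotopic C y z bs bs'"
  shows "homotopic C x z (as @ bs) (as' @ bs')"
proof -
  have "homotopic C x z ([] @ as @ bs) ([] @ as' @ bs)"
    using assms by (intro homotopic_extend) (auto dest: homotopic_imp_paths is_path_source)
  moreover have "homotopic C x z (as' @ bs @ []) (as' @ bs' @ [])"
    using assms by (intro homotopic_extend) (auto dest: homotopic_imp_paths is_path_target)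
  ultimately show ?thesis by (auto intro: homotopic.trans)
qed

lemma homotopic_commute: "homotopic C x y as bs \<longleftrightarrow> homotopic C x y bs as"
  by (blast intro: homotopic.sym)

lemma inv_path_Nil [simp]: "inv_path C [] = []"
  and inv_path_Cons [simp]: "inv_path C (e # es) = inv_path C es @ [inv_edge C e]"
  and inv_path_append [simp]: "inv_path C (as @ bs) = inv_path C bs @ inv_path C as"
  by (auto simp: inv_path_def)

context serre_complex
begin

lemma is_path_inv_path: "is_path C x es y \<Longrightarrow> is_path C y (inv_path C es) x"
  by (induction es arbitrary: x)
    (auto simp: is_path_append inv_edge_closed source_inv_edge target_inv_edge dest: is_path_source)

lemma inv_path_involution: "is_path C x es y \<Longrightarrow> inv_path C (inv_path C es) = es"
  by (induction es arbitrary: x) (auto simp: inv_edge_involution)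

lemma homotopic_inv_right: "is_path C x es y \<Longrightarrow> homotopic C x x (es @ inv_path C es) []"
proof (induction es arbitrary: x)
  case (Cons e es)
  define m where "m = target C e"
  have e: "is_path C x [e] m" and e': "is_path C m [inv_edge C e] x" and es: "is_path C m es y"
    using Cons.prems
    by (auto simp: m_def inv_edge_closed source_inv_edge target_inv_edge dest: is_path_source)
  have "homotopic C x x ([e] @ (es @ inv_path C es) @ [inv_edge C e]) ([e] @ [] @ [inv_edge C e])"
    by (rule homotopic_extend[OF Cons.IH[OF es] e e'])
  moreover have "homotopic C x x ([] @ [e, inv_edge C e] @ []) ([] @ [])"
    using is_path_appendI[OF e e'] is_path_source[OF e] by (intro homotopic.backtrack) auto
  ultimately show ?case by (auto intro: homotopic.trans)
qed (auto intro: homotopic.refl)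

lemma homotopic_inv_left: "is_path C x es y \<Longrightarrow> homotopic C y y (inv_path C es @ es) []"
  using homotopic_inv_right[OF is_path_inv_path] by (simp add: inv_path_involution)

text \<open>In a groupoid \<open>ab = cd\<close> gives \<open>a\<inverse>c = bd\<inverse>\<close>. This transports a commuting square of edges to the
  square in which one of the two parallel pairs of edges is reversed.\<close>

lemma homotopic_flip_square:
  assumes sq: "homotopic C x z (as @ bs) (cs @ ds)"
    and as: "is_path C x as y" and cs: "is_path C x cs y'"
  shows "homotopic C y y' (inv_path C as @ cs) (bs @ inv_path C ds)"
proof -
  have bs: "is_path C y bs z" and ds: "is_path C y' ds z"
    using homotopic_imp_paths[OF sq] as cs by (auto simp: is_path_append dest: is_path_end_unique)
  note inv = is_path_inv_path[OF as] is_path_inv_path[OF ds]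
  have 1: "homotopic C y y' ((inv_path C as @ cs) @ []) ((inv_path C as @ cs) @ (ds @ inv_path C ds))"
    by (rule homotopic_append[OF homotopic.refl homotopic.sym[OF homotopic_inv_right[OF ds]]])
      (rule is_path_appendI[OF inv(1) cs])
  have 2: "homotopic C y y' (inv_path C as @ (cs @ ds) @ inv_path C ds)
      (inv_path C as @ (as @ bs) @ inv_path C ds)"
    by (rule homotopic_extend[OF homotopic.sym[OF sq] inv])
  have 3: "homotopic C y y' ((inv_path C as @ as) @ (bs @ inv_path C ds))
      ([] @ (bs @ inv_path C ds))"
    by (rule homotopic_append[OF homotopic_inv_left[OF as] homotopic.refl])
      (rule is_path_appendI[OF bs inv(2)])
  from 1 2 3 show ?thesis by (simp, metis homotopic.trans)
qed

lemma homotopic_of_null_loop: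
  assumes null: "homotopic C x x (as @ inv_path C bs) []"
    and as: "is_path C x as y" and bs: "is_path C x bs y"
  shows "homotopic C x y as bs"
proof -
  have 1: "homotopic C x y (as @ []) (as @ (inv_path C bs @ bs))"
    by (rule homotopic_append[OF homotopic.refl homotopic.sym[OF homotopic_inv_left]]) fact+
  have 2: "homotopic C x y ((as @ inv_path C bs) @ bs) ([] @ bs)"
    by (rule homotopic_append[OF null homotopic.refl[OF bs]])
  from 1 2 show ?thesis by (simp, metis homotopic.trans)
qed

lemma homotopic_cancel_right:
  assumes hom: "homotopic C x z (as @ cs) (bs @ cs)"
    and as: "is_path C x as y" and bs: "is_path C x bs y" and cs: "is_path C y cs z"
  shows "homotopic C x y as bs"
proof -
  have null: "homotopic C x y (ds @ cs @ inv_path C cs) (ds @ [])" if "is_path C x ds y" for ds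
    by (rule homotopic_append[OF homotopic.refl[OF that] homotopic_inv_right[OF cs]])
  have "homotopic C x y ((as @ cs) @ inv_path C cs) ((bs @ cs) @ inv_path C cs)"
    by (rule homotopic_append[OF hom homotopic.refl[OF is_path_inv_path[OF cs]]])
  with null[OF as] null[OF bs] show ?thesis
    by (simp, metis homotopic.sym homotopic.trans)
qed

end

text \<open>A map of complexes that may send an edge to an edge path, in particular to a constant one, and
  that only has to be defined on a set \<open>S\<close> of vertices closed under edges. Allowing constant images
  covers the projections of a product to its factors, where an edge of one factor vanishes in the
  other; restricting to \<open>S\<close> allows maps that make sense on a single component only.\<close>

locale path_map = target: serre_complex C
  for C :: "('v, 'e, 'm) complex2_scheme" +
  fixes B :: "('w, 'd, 'n) complex2_scheme" and S :: "'w set"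
    and g :: "'w \<Rightarrow> 'v" and f :: "'d \<Rightarrow> 'e list"
  assumes vertex_image: "s \<in> S \<Longrightarrow> g s \<in> vertices C"
    and step_closed: "e \<in> edges B \<Longrightarrow> source B e \<in> S \<Longrightarrow> target B e \<in> S"
    and edge_image: "e \<in> edges B \<Longrightarrow> source B e \<in> S \<Longrightarrow>
      is_path C (g (source B e)) (f e) (g (target B e))"
    and inv_edge_image: "e \<in> edges B \<Longrightarrow> source B e \<in> S \<Longrightarrow> f (inv_edge B e) = inv_path C (f e)"
    and cell_image: "c \<in> boundaries B \<Longrightarrow> s \<in> S \<Longrightarrow> is_path B s c s \<Longrightarrow>
      homotopic C (g s) (g s) (concat (map f c)) []"
begin

lemma path_closed: "is_path B x es y \<Longrightarrow> x \<in> S \<Longrightarrow> y \<in> S"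
  by (induction es arbitrary: x) (auto dest: step_closed)

lemma path_image: "is_path B x es y \<Longrightarrow> x \<in> S \<Longrightarrow> is_path C (g x) (concat (map f es)) (g y)"
  by (induction es arbitrary: x) (auto simp: vertex_image intro: is_path_appendI edge_image dest: step_closed)

text \<open>Both elementary homotopies insert a closed subpath, so it is enough that the images of
  backtracks and of cells are null-homotopic.\<close>

lemma homotopic_image:
  assumes "homotopic B x y as bs" "x \<in> S"
  shows "homotopic C (g x) (g y) (concat (map f as)) (concat (map f bs))"
  using assms(1)
proof (induction rule: homotopic.induct)
  case (backtrack as bs e)
  obtain s where as: "is_path B x as s" and e: "e \<in> edges B" "source B e = s"
    using backtrack.hyps(2) by (auto simp: is_path_append)
  have bs: "is_path B s bs y"
    using backtrack.hyps(1) as by (auto simp: is_path_append dest: is_path_end_unique)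
  have s: "s \<in> S" by (rule path_closed[OF as \<open>x \<in> S\<close>])
  have "homotopic C (g s) (g s) (f e @ inv_path C (f e)) []"
    using e s by (intro target.homotopic_inv_right) (auto intro: edge_image)
  from homotopic_extend[OF this path_image[OF as \<open>x \<in> S\<close>] path_image[OF bs s]]
  show ?case using e s by (simp add: inv_edge_image)
next
  case (cell c as bs)
  obtain s t where as: "is_path B x as s" and c: "is_path B s c t" and bs: "is_path B t bs y"
    using cell.hyps(3) by (auto simp: is_path_append)
  have bs': "is_path B s bs y"
    using cell.hyps(2) as by (auto simp: is_path_append dest: is_path_end_unique)
  \<comment> \<open>The cell is closed because the path continues along the same edges with and without it.\<close>
  have "t = s" using bs bs' by (cases bs) auto
  have s: "s \<in> S" by (rule path_closed[OF as \<open>x \<in> S\<close>])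
  have "homotopic C (g s) (g s) (concat (map f c)) []"
    using cell.hyps(1) s c \<open>t = s\<close> by (intro cell_image) auto
  from homotopic_extend[OF this path_image[OF as \<open>x \<in> S\<close>] path_image[OF bs' s]]
  show ?case by simp
next
  case (refl as)
  then show ?case by (intro homotopic.refl path_image[OF _ \<open>x \<in> S\<close>])
next
  case (sym as bs)
  then show ?case by (blast intro: homotopic.sym)
next
  case (trans as bs cs)
  then show ?case by (blast intro: homotopic.trans)
qed

end

section \<open>The fundamental group\<close>

definition homotopy_class :: "('v, 'e, 'm) complex2_scheme \<Rightarrow> 'v \<Rightarrow> 'e list \<Rightarrow> 'e list set" where
  "homotopy_class C x es = loop_homotopy C x `` {es}"

lemma equiv_loop_homotopy: "equiv (loops C x) (loop_homotopy C x)"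
proof (rule equivI)
  show "loop_homotopy C x \<subseteq> loops C x \<times> loops C x"
    by (auto simp: loop_homotopy_def loops_def dest: homotopic_imp_paths)
  show "refl_on (loops C x) (loop_homotopy C x)"
    by (auto simp: loop_homotopy_def loops_def refl_on_def intro: homotopic.refl)
  show "sym (loop_homotopy C x)"
    by (auto simp: loop_homotopy_def sym_def intro: homotopic.sym)
  show "trans (loop_homotopy C x)"
    unfolding loop_homotopy_def trans_def by (blast intro: homotopic.trans)
qed

lemma homotopy_class_eq_iff:
  "is_path C x as x \<Longrightarrow> is_path C x bs x \<Longrightarrow>
    homotopy_class C x as = homotopy_class C x bs \<longleftrightarrow> homotopic C x x as bs"
  unfolding homotopy_class_def
  by (subst eq_equiv_class_iff[OF equiv_loop_homotopy]) (auto simp: loops_def loop_homotopy_def)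

lemma homotopy_class_eqI: "homotopic C x x as bs \<Longrightarrow> homotopy_class C x as = homotopy_class C x bs"
  using homotopic_imp_paths[of C x x as bs] by (simp add: homotopy_class_eq_iff)

lemma in_homotopy_class_iff: "bs \<in> homotopy_class C x as \<longleftrightarrow> homotopic C x x as bs"
  by (simp add: homotopy_class_def loop_homotopy_def)

lemma carrier_fundamental_group:
  "carrier (fundamental_group C x) = homotopy_class C x ` {es. is_path C x es x}"
  by (auto simp: fundamental_group_def quotient_def homotopy_class_def loops_def)

lemma one_fundamental_group: "\<one>\<^bsub>fundamental_group C x\<^esub> = homotopy_class C x []"
  by (simp add: fundamental_group_def homotopy_class_def)

lemma mult_fundamental_group:
  assumes "is_path C x as x" "is_path C x bs x"
  shows "homotopy_class C x as \<otimes>\<^bsub>fundamental_group C x\<^esub> homotopy_class C x bs =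
    homotopy_class C x (as @ bs)"
proof -
  have eq: "homotopy_class C x (as' @ bs') = homotopy_class C x (as @ bs)"
    if "as' \<in> homotopy_class C x as" "bs' \<in> homotopy_class C x bs" for as' bs'
    using that unfolding in_homotopy_class_iff
    by (intro homotopy_class_eqI homotopic_append[OF homotopic.sym homotopic.sym])
  have "homotopy_class C x as \<noteq> {}" "homotopy_class C x bs \<noteq> {}"
    using assms in_homotopy_class_iff homotopic.refl by (metis empty_iff)+
  with eq have "(\<Union>as'\<in>homotopy_class C x as. \<Union>bs'\<in>homotopy_class C x bs.
      homotopy_class C x (as' @ bs')) = homotopy_class C x (as @ bs)"
    by (simp cong: SUP_cong)
  then show ?thesis by (simp add: fundamental_group_def homotopy_class_def)
qed

lemma fundamental_group_cases:
  assumes "X \<in> carrier (fundamental_group C x)"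
  obtains es where "is_path C x es x" "X = homotopy_class C x es"
  using assms by (auto simp: carrier_fundamental_group)

lemma homotopy_class_in_carrier:
  "is_path C x es x \<Longrightarrow> homotopy_class C x es \<in> carrier (fundamental_group C x)"
  by (simp add: carrier_fundamental_group)

lemma (in serre_complex) group_fundamental_group:
  assumes x: "x \<in> vertices C"
  shows "group (fundamental_group C x)" (is "group ?G")
proof (rule groupI)
  fix X Y assume "X \<in> carrier ?G" "Y \<in> carrier ?G"
  then show "X \<otimes>\<^bsub>?G\<^esub> Y \<in> carrier ?G"
    by (elim fundamental_group_cases)
      (simp add: mult_fundamental_group homotopy_class_in_carrier is_path_appendI)
next
  fix X Y Z assume "X \<in> carrier ?G" "Y \<in> carrier ?G" "Z \<in> carrier ?G"
  then show "X \<otimes>\<^bsub>?G\<^esub> Y \<otimes>\<^bsub>?G\<^esub> Z = X \<otimes>\<^bsub>?G\<^esub> (Y \<otimes>\<^bsub>?G\<^esub> Z)"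
    by (elim fundamental_group_cases)
      (simp add: mult_fundamental_group is_path_appendI)
next
  show "\<one>\<^bsub>?G\<^esub> \<in> carrier ?G"
    using x by (simp add: one_fundamental_group homotopy_class_in_carrier)
next
  fix X assume "X \<in> carrier ?G"
  then show "\<one>\<^bsub>?G\<^esub> \<otimes>\<^bsub>?G\<^esub> X = X"
    using x by (elim fundamental_group_cases) (simp add: one_fundamental_group mult_fundamental_group)
next
  fix X assume "X \<in> carrier ?G"
  then obtain es where es: "is_path C x es x" and X: "X = homotopy_class C x es"
    by (rule fundamental_group_cases)
  have "homotopy_class C x (inv_path C es) \<otimes>\<^bsub>?G\<^esub> X = \<one>\<^bsub>?G\<^esub>"
    unfolding X one_fundamental_group mult_fundamental_group[OF is_path_inv_path[OF es] es]
    by (rule homotopy_class_eqI[OF homotopic_inv_left[OF es]])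
  then show "\<exists>Y\<in>carrier ?G. Y \<otimes>\<^bsub>?G\<^esub> X = \<one>\<^bsub>?G\<^esub>"
    using homotopy_class_in_carrier[OF is_path_inv_path[OF es]] by blast
qed

section \<open>Squier complexes\<close>

text \<open>A relation may be applied in either direction; the cells of a Squier complex are only given for
  the positive orientation.\<close>

definition rewriting :: "'a presentation \<Rightarrow> 'a list \<Rightarrow> 'a list \<Rightarrow> bool" where
  "rewriting P u v \<longleftrightarrow> (u, v) \<in> relations P \<or> (v, u) \<in> relations P"

lemma rewriting_sym: "rewriting P u v \<Longrightarrow> rewriting P v u"
  by (auto simp: rewriting_def)

lemma squier_complex_simps [simp]:
  "vertices (squier_complex P) = nonempty_words P"
  "(p, u, v, q) \<in> edges (squier_complex P) \<longleftrightarrow>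
    p \<in> lists (letters P) \<and> q \<in> lists (letters P) \<and> rewriting P u v"
  "source (squier_complex P) (p, u, v, q) = p @ u @ q"
  "target (squier_complex P) (p, u, v, q) = p @ v @ q"
  "inv_edge (squier_complex P) (p, u, v, q) = (p, v, u, q)"
  by (auto simp: squier_complex_def squier_graph_def rewriting_def)

lemma boundaries_squier_complex:
  "c \<in> boundaries (squier_complex P) \<longleftrightarrow> (\<exists>p z q l1 r1 l2 r2.
     c = [(p, l1, r1, z @ l2 @ q), (p @ r1 @ z, l2, r2, q),
          (p, r1, l1, z @ r2 @ q), (p @ l1 @ z, r2, l2, q)] \<and>
     p \<in> lists (letters P) \<and> z \<in> lists (letters P) \<and> q \<in> lists (letters P) \<and>
     (l1, r1) \<in> relations P \<and> (l2, r2) \<in> relations P)"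
  by (auto simp: squier_complex_def squier_graph_def inv_path_def)

lemma squier_boundary_cases:
  assumes "c \<in> boundaries (squier_complex P)"
  obtains p z q l1 r1 l2 r2 where
    "c = [(p, l1, r1, z @ l2 @ q), (p @ r1 @ z, l2, r2, q),
          (p, r1, l1, z @ r2 @ q), (p @ l1 @ z, r2, l2, q)]"
    "rewriting P l1 r1" "rewriting P l2 r2"
    "p \<in> lists (letters P)" "z \<in> lists (letters P)" "q \<in> lists (letters P)"
  using assms unfolding boundaries_squier_complex rewriting_def by blast

lemma rewriting_nonempty_words:
  "semigroup_presentation P \<Longrightarrow> rewriting P u v \<Longrightarrow> u \<in> nonempty_words P \<and> v \<in> nonempty_words P"
  by (auto simp: semigroup_presentation_def rewriting_def)

lemma nonempty_words_iff: "w \<in> nonempty_words P \<longleftrightarrow> w \<in> lists (letters P) \<and> w \<noteq> []"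
  by (auto simp: nonempty_words_def)

lemma serre_complex_squier_complex:
  assumes "semigroup_presentation P"
  shows "serre_complex (squier_complex P)"
proof
  fix e assume "e \<in> edges (squier_complex P)"
  moreover obtain p u v q where "e = (p, u, v, q)" by (metis prod.exhaust)
  ultimately show "target (squier_complex P) e \<in> vertices (squier_complex P)"
    using rewriting_nonempty_words[OF assms, of u v] by (auto simp: nonempty_words_iff)
qed (auto simp: rewriting_sym)

text \<open>Disjoint applications of relations commute in every orientation: the cells give the positive
  case, and reversing either relation flips the commuting square.\<close>

lemma squier_commute:
  assumes P: "semigroup_presentation P"
    and words: "p \<in> lists (letters P)" "z \<in> lists (letters P)" "q \<in> lists (letters P)"
    and rew: "rewriting P u1 v1" "rewriting P u2 v2"
  shows "homotopic (squier_complex P) (p @ u1 @ z @ u2 @ q) (p @ v1 @ z @ v2 @ q)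
    [(p, u1, v1, z @ u2 @ q), (p @ v1 @ z, u2, v2, q)]
    [(p @ u1 @ z, u2, v2, q), (p, u1, v1, z @ v2 @ q)]"
proof -
  interpret serre_complex "squier_complex P" by (rule serre_complex_squier_complex[OF P])
  define sq where "sq u1 v1 u2 v2 \<longleftrightarrow>
    homotopic (squier_complex P) (p @ u1 @ z @ u2 @ q) (p @ v1 @ z @ v2 @ q)
      [(p, u1, v1, z @ u2 @ q), (p @ v1 @ z, u2, v2, q)]
      [(p @ u1 @ z, u2, v2, q), (p, u1, v1, z @ v2 @ q)]" for u1 v1 u2 v2
  note rewriting_words = rewriting_nonempty_words[OF P, unfolded nonempty_words_iff]
  have rel: "sq l1 r1 l2 r2" if r: "(l1, r1) \<in> relations P" "(l2, r2) \<in> relations P" for l1 r1 l2 r2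
  proof -
    have rw: "rewriting P l1 r1" "rewriting P l2 r2" "rewriting P r1 l1" "rewriting P r2 l2"
      using r by (auto simp: rewriting_def)
    let ?a = "[(p, l1, r1, z @ l2 @ q), (p @ r1 @ z, l2, r2, q)]"
    let ?b = "[(p @ l1 @ z, l2, r2, q), (p, l1, r1, z @ r2 @ q)]"
    have "?a @ inv_path (squier_complex P) ?b \<in> boundaries (squier_complex P)"
      unfolding boundaries_squier_complex
      by (insert words r, rule exI[of _ p], rule exI[of _ z], rule exI[of _ q], rule exI[of _ l1],
          rule exI[of _ r1], rule exI[of _ l2], rule exI[of _ r2]) simp
    moreover have a: "is_path (squier_complex P) (p @ l1 @ z @ l2 @ q) ?a (p @ r1 @ z @ r2 @ q)"
      and b: "is_path (squier_complex P) (p @ l1 @ z @ l2 @ q) ?b (p @ r1 @ z @ r2 @ q)"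
      using words rw rewriting_words[OF rw(1)] rewriting_words[OF rw(2)]
      by (auto simp: nonempty_words_iff)
    ultimately have "homotopic (squier_complex P) (p @ l1 @ z @ l2 @ q) (p @ l1 @ z @ l2 @ q)
        ([] @ (?a @ inv_path (squier_complex P) ?b) @ []) ([] @ [])"
      using is_path_appendI[OF a is_path_inv_path[OF b]] is_path_source[OF a]
      by (intro homotopic.cell) simp_all
    then have "homotopic (squier_complex P) (p @ l1 @ z @ l2 @ q) (p @ l1 @ z @ l2 @ q)
        (?a @ inv_path (squier_complex P) ?b) []"
      by (simp only: append_Nil append_Nil2)
    from homotopic_of_null_loop[OF this a b] show ?thesis unfolding sq_def .
  qed
  have flip1: "sq v1 u1 u2 v2" if "sq u1 v1 u2 v2" "rewriting P u1 v1" "rewriting P u2 v2" for u1 v1 u2 v2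
  proof -
    have "homotopic (squier_complex P) (p @ v1 @ z @ u2 @ q) (p @ u1 @ z @ v2 @ q)
        (inv_path (squier_complex P) [(p, u1, v1, z @ u2 @ q)] @ [(p @ u1 @ z, u2, v2, q)])
        ([(p @ v1 @ z, u2, v2, q)] @ inv_path (squier_complex P) [(p, u1, v1, z @ v2 @ q)])"
      by (rule homotopic_flip_square)
        (use that words rewriting_words[OF that(2)] rewriting_words[OF that(3)] in
          \<open>auto simp: sq_def nonempty_words_iff\<close>)
    then show ?thesis unfolding sq_def by simp
  qed
  have flip2: "sq u1 v1 v2 u2" if "sq u1 v1 u2 v2" "rewriting P u1 v1" "rewriting P u2 v2" for u1 v1 u2 v2
  proof -
    have "homotopic (squier_complex P) (p @ u1 @ z @ v2 @ q) (p @ v1 @ z @ u2 @ q)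
        (inv_path (squier_complex P) [(p @ u1 @ z, u2, v2, q)] @ [(p, u1, v1, z @ u2 @ q)])
        ([(p, u1, v1, z @ v2 @ q)] @ inv_path (squier_complex P) [(p @ v1 @ z, u2, v2, q)])"
      by (rule homotopic_flip_square, rule homotopic.sym)
        (use that words rewriting_words[OF that(2)] rewriting_words[OF that(3)] in
          \<open>auto simp: sq_def nonempty_words_iff\<close>)
    then show ?thesis unfolding sq_def by (subst homotopic_commute) simp
  qed
  have "sq u1 v1 u2 v2"
    using rew rel flip1 flip2 unfolding rewriting_def by blast
  then show ?thesis by (simp add: sq_def)
qed

lemma squier_cell_null:
  assumes P: "semigroup_presentation P"
    and words: "p \<in> lists (letters P)" "z \<in> lists (letters P)" "q \<in> lists (letters P)"
    and rew: "rewriting P u1 v1" "rewriting P u2 v2"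
  shows "homotopic (squier_complex P) (p @ u1 @ z @ u2 @ q) (p @ u1 @ z @ u2 @ q)
    [(p, u1, v1, z @ u2 @ q), (p @ v1 @ z, u2, v2, q),
     (p, v1, u1, z @ v2 @ q), (p @ u1 @ z, v2, u2, q)] []"
proof -
  interpret serre_complex "squier_complex P" by (rule serre_complex_squier_complex[OF P])
  note commute = squier_commute[OF assms]
  have path: "is_path (squier_complex P) (p @ u1 @ z @ u2 @ q)
      [(p @ u1 @ z, u2, v2, q), (p, u1, v1, z @ v2 @ q)] (p @ v1 @ z @ v2 @ q)"
    using homotopic_imp_paths[OF commute] by blast
  from homotopic.trans[OF homotopic_append[OF commute homotopic.refl[OF is_path_inv_path[OF path]]]
      homotopic_inv_right[OF path]]
  show ?thesis by simp
qed

section \<open>The presentation of the power\<close>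

text \<open>One of the new letters is \<open>Inr 1\<close>; rewriting its numeral to \<open>Suc 0\<close> would hide it from the lemmas
  that mention it.\<close>

declare One_nat_def [simp del]

abbreviation opener :: "'a + nat" where "opener \<equiv> Inr 0"
abbreviation closer :: "'a + nat" where "closer \<equiv> Inr 1"
abbreviation reservoir :: "'a + nat" where "reservoir \<equiv> Inr 2"

abbreviation block :: "'a list \<Rightarrow> ('a + nat) list \<Rightarrow> ('a + nat) list" where
  "block v r \<equiv> opener # map Inl v @ closer # r"

text \<open>The reservoir supplies a fresh copy of \<open>w\<close>, enclosed in a pair of brackets, as often as needed.
  The opening bracket matters: with only a separator after \<open>w\<close>, a last factor \<open>vw\<close> could lose its
  suffix \<open>w\<close> to the reservoir and leave \<open>v\<close> behind, outside any block.\<close>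

definition power_presentation :: "'a presentation \<Rightarrow> 'a list \<Rightarrow> ('a + nat) presentation" where
  "power_presentation P w = \<lparr>
     letters = Inl ` letters P \<union> {opener, closer, reservoir},
     relations = map_prod (map Inl) (map Inl) ` relations P \<union> {([reservoir], block w [reservoir])}\<rparr>"

locale pointed_presentation =
  fixes P :: "'a presentation" and w :: "'a list"
  assumes semigroup_presentation: "semigroup_presentation P"
    and base_word: "w \<in> nonempty_words P"
begin

abbreviation "Q \<equiv> power_presentation P w"
abbreviation "K \<equiv> squier_complex P"
abbreviation "L \<equiv> squier_complex Q"

lemma map_Inl_in_lists [simp]: "map Inl v \<in> lists (letters Q) \<longleftrightarrow> v \<in> lists (letters P)"
  by (auto simp: power_presentation_def lists_eq_set)

lemma new_letters [simp]: "opener \<in> letters Q" "closer \<in> letters Q" "reservoir \<in> letters Q"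
  by (auto simp: power_presentation_def)

lemma map_Inl_in_nonempty_words: "map Inl v \<in> nonempty_words Q \<longleftrightarrow> v \<in> nonempty_words P"
  by (simp only: nonempty_words_iff map_Inl_in_lists map_is_Nil_conv)

lemma semigroup_presentation_power: "semigroup_presentation Q"
proof -
  have "relations Q \<subseteq> nonempty_words Q \<times> nonempty_words Q"
  proof (rule subrelI)
    fix u v assume "(u, v) \<in> relations Q"
    then consider u' v' where "(u', v') \<in> relations P" "u = map Inl u'" "v = map Inl v'"
      | "u = [reservoir]" "v = block w [reservoir]"
      by (auto simp: power_presentation_def)
    then show "(u, v) \<in> nonempty_words Q \<times> nonempty_words Q"
    proof cases
      case 1
      then show ?thesis
        using semigroup_presentation map_Inl_in_nonempty_words
        by (auto simp: semigroup_presentation_def)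
    next
      case 2
      have "block w [reservoir] \<in> lists (letters Q)"
        using base_word by (simp add: nonempty_words_iff)
      then show ?thesis using 2 by (simp add: nonempty_words_iff)
    qed
  qed
  moreover have "asym (relations Q)"
  proof (rule asymI)
    fix u v assume "(u, v) \<in> relations Q"
    then show "(v, u) \<notin> relations Q"
      using semigroup_presentation asymD[of "relations P"]
      by (auto simp: power_presentation_def semigroup_presentation_def inj_map_eq_map)
  qed
  ultimately show ?thesis by (simp add: semigroup_presentation_def)
qed

sublocale K: serre_complex K
  by (rule serre_complex_squier_complex[OF semigroup_presentation])

sublocale L: serre_complex L
  by (rule serre_complex_squier_complex[OF semigroup_presentation_power])

lemma rewriting_power_iff:
  "rewriting Q u v \<longleftrightarrow> (\<exists>u' v'. u = map Inl u' \<and> v = map Inl v' \<and> rewriting P u' v') \<or>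
    u = [reservoir] \<and> v = block w [reservoir] \<or> u = block w [reservoir] \<and> v = [reservoir]"
  by (auto simp: rewriting_def power_presentation_def)

lemma rewriting_map_Inl: "rewriting P u v \<Longrightarrow> rewriting Q (map Inl u) (map Inl v)"
  by (auto simp: rewriting_power_iff)

section \<open>States, their edges and their cells\<close>

text \<open>The words \<open>(v\<^sub>1)(v\<^sub>2)\<dots>(v\<^sub>n)x\<close>, where \<open>x\<close> is the reservoir. This set contains the component of
  \<open>x\<close>: it is closed under edges. The recursion reflects the decomposition of the states other
  than \<open>x\<close> as a product of words over \<open>P\<close> and states, on which the whole proof rests.\<close>

inductive_set states :: "('a + nat) list set" where
  reservoir: "[reservoir] \<in> states"
| block: "v \<in> nonempty_words P \<Longrightarrow> r \<in> states \<Longrightarrow> block v r \<in> states"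

lemma states_subset: "s \<in> states \<Longrightarrow> s \<in> nonempty_words Q"
  by (induction rule: states.induct) (auto simp: nonempty_words_iff)

text \<open>The lone reservoir \<open>x\<close> counts as \<open>(w)x\<close>, the word it expands to, so that \<open>first_factor\<close> and \<open>rest\<close>
  do not change when these two words are rewritten into each other.\<close>

definition first_factor :: "('a + nat) list \<Rightarrow> 'a list" where
  "first_factor s = (if closer \<in> set s then map projl (tl (takeWhile (\<lambda>x. x \<noteq> closer) s)) else w)"

definition rest :: "('a + nat) list \<Rightarrow> ('a + nat) list" where
  "rest s = (if closer \<in> set s then tl (dropWhile (\<lambda>x. x \<noteq> closer) s) else [reservoir])"

text \<open>An edge between states acts inside the first factor, or behind the first closing bracket, or it
  expands or contracts the whole word. The left context \<open>p\<close> tells these apart: it is nonempty without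
  a closing bracket, or it contains a closing bracket, or it is empty. An edge of the last kind
  disappears in both projections.\<close>

fun first_edge :: "('a + nat) squier_edge \<Rightarrow> 'a squier_edge list" where
  "first_edge (p, u, v, q) = (if p = [] \<or> closer \<in> set p then []
     else [(map projl (tl p), map projl u, map projl v, map projl (takeWhile (\<lambda>x. x \<noteq> closer) q))])"

fun rest_edge :: "('a + nat) squier_edge \<Rightarrow> ('a + nat) squier_edge list" where
  "rest_edge (p, u, v, q) =
     (if closer \<in> set p then [(tl (dropWhile (\<lambda>x. x \<noteq> closer) p), u, v, q)] else [])"

text \<open>The action on one factor of a block, with the other factor kept fixed.\<close>

fun left_edge :: "('a + nat) list \<Rightarrow> 'a squier_edge \<Rightarrow> ('a + nat) squier_edge list" where
  "left_edge r (p, u, v, q) = [(opener # map Inl p, map Inl u, map Inl v, map Inl q @ closer # r)]"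

fun right_edge :: "'a list \<Rightarrow> ('a + nat) squier_edge \<Rightarrow> ('a + nat) squier_edge list" where
  "right_edge a (p, u, v, q) = [(block a p, u, v, q)]"

lemma takeWhile_map_Inl [simp]:
  "takeWhile (\<lambda>x. x \<noteq> closer) (map Inl v @ s) = map Inl v @ takeWhile (\<lambda>x. x \<noteq> closer) s"
  by (subst takeWhile_append2) auto

lemma dropWhile_map_Inl [simp]:
  "dropWhile (\<lambda>x. x \<noteq> closer) (map Inl v @ s) = dropWhile (\<lambda>x. x \<noteq> closer) s"
  by (subst dropWhile_append2) auto

lemma projl_comp_Inl [simp]: "projl \<circ> Inl = (\<lambda>x. x)"
  by auto

lemma Inr_notin_Inl_image [simp]: "Inr n \<notin> Inl ` A"
  by auto

lemma first_factor_simps [simp]: "first_factor [reservoir] = w" "first_factor (block v r) = v"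
  by (auto simp: first_factor_def comp_def)

lemma rest_simps [simp]: "rest [reservoir] = [reservoir]" "rest (block v r) = r"
  by (auto simp: rest_def)

lemma first_occurrence_unique:
  assumes "xs @ x # ys = xs' @ x # ys'" "x \<notin> set xs" "x \<notin> set xs'"
  shows "xs = xs'" "ys = ys'"
  using assms by (auto simp: append_eq_append_conv2 append_eq_Cons_conv Cons_eq_append_conv)

lemma split_before_first:
  assumes eq: "p @ u @ q = l @ x # r" and x: "x \<notin> set p" "x \<notin> set u" "x \<notin> set l"
  obtains b where "l = p @ u @ b" "q = b @ x # r"
proof -
  have "x \<in> set (p @ u @ q)" unfolding eq by simp
  then have "x \<in> set q" using x by simp
  then obtain b r' where q: "q = b @ x # r'" "x \<notin> set b"
    by (metis split_list_first)
  then have "l @ x # r = (p @ u @ b) @ x # r'" using eq by simp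
  then have "l = p @ u @ b" "r = r'"
    by (rule first_occurrence_unique; use x q in simp)+
  then show thesis using q that by blast
qed

text \<open>The position of the edge relative to the first closing bracket decides. If the left context
  \<open>p\<close> contains that bracket, the edge acts behind it. Otherwise a relation of \<open>P\<close> stays inside the
  first factor, because its letters are no brackets; an expansion cannot occur, because the
  reservoir is the last letter of a state; and a contraction contains an opening bracket and
  therefore begins at the start of the word, so that it consumes the whole first block and leaves
  nothing behind it.\<close>

lemma state_edge_cases [consumes 2, case_names rest first expand contract]:
  assumes e: "(p, u, v, q) \<in> edges L" and s: "p @ u @ q \<in> states"
  obtains a p' where "p = block a p'" "a \<in> nonempty_words P" "p' @ u @ q \<in> states"
      "(p', u, v, q) \<in> edges L"
    | a b u' v' r where "p = opener # map Inl a" "q = map Inl b @ closer # r"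
      "u = map Inl u'" "v = map Inl v'" "(a, u', v', b) \<in> edges K" "r \<in> states"
      "a @ u' @ b \<in> nonempty_words P"
    | "p = []" "q = []" "u = [reservoir]" "v = block w [reservoir]"
    | "p = []" "q = []" "u = block w [reservoir]" "v = [reservoir]"
proof (cases "closer \<in> set p")
  case True
  then obtain p1 p' where p: "p = p1 @ closer # p'" "closer \<notin> set p1"
    by (metis split_list_first)
  with s show thesis
  proof (cases rule: states.cases)
    case (block a r)
    then have "p1 @ closer # (p' @ u @ q) = (opener # map Inl a) @ closer # r"
      using p by simp
    then have "p1 = opener # map Inl a" "p' @ u @ q = r"
      by (rule first_occurrence_unique; use p(2) in force)+
    then show thesis using that(1)[of a p'] block p e by auto
  qed (auto simp: append_eq_Cons_conv)
next
  case False
  have u: "u \<noteq> []"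
    using e rewriting_nonempty_words[OF semigroup_presentation_power, of u v] by (auto simp: nonempty_words_iff)
  from s show thesis
  proof (cases rule: states.cases)
    case reservoir
    then have "p = []" "q = []" "u = [reservoir]" using u by (auto simp: append_eq_Cons_conv)
    then show thesis using that(3) e by (auto simp: rewriting_power_iff)
  next
    case (block a r)
    then have eq: "p @ u @ q = (opener # map Inl a) @ closer # r" by simp
    have a: "closer \<notin> set (opener # map Inl a)" "reservoir \<notin> set (opener # map Inl a)"
      "opener \<notin> set (map Inl a)" by auto
    consider u' v' where "u = map Inl u'" "v = map Inl v'" "rewriting P u' v'"
      | "u = [reservoir]" | "u = block w [reservoir]" "v = [reservoir]"
      using e by (auto simp: rewriting_power_iff)
    then show thesis
    proof cases
      case 1
      then obtain b where b: "opener # map Inl a = p @ u @ b" "q = b @ closer # r"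
        using split_before_first[OF eq False _ a(1)] by auto
      obtain p' where p: "p = opener # p'" "map Inl a = p' @ map Inl u' @ b"
        using b(1) 1 u by (cases p; cases u') auto
      then obtain a1 a2 where "p' = map Inl a1" "b = map Inl a2" "a = a1 @ u' @ a2"
        by (auto simp: map_eq_append_conv append_eq_map_conv inj_map_eq_map)
      then show thesis using that(2)[of a1 a2 r u' v'] p b 1 block by (auto simp: nonempty_words_iff)
    next
      case 2
      then obtain b where "opener # map Inl a = p @ [reservoir] @ b"
        using split_before_first[OF eq False _ a(1)] by auto
      then have "reservoir \<in> set (opener # map Inl a)" by simp
      then show thesis using a by simp
    next
      case 3
      have "(opener # map Inl a) @ closer # r = (p @ opener # map Inl w) @ closer # (reservoir # q)"
        using eq 3 by simp
      then have pa: "opener # map Inl a = p @ opener # map Inl w" and r: "r = reservoir # q"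
        by (rule first_occurrence_unique; use a False in force)+
      have "p = []"
      proof (cases p)
        case (Cons x p')
        then have "opener \<in> set (map Inl a)" using pa by simp
        then show ?thesis using a by simp
      qed
      moreover have "q = []" using block(3) unfolding r by (cases rule: states.cases) auto
      ultimately show thesis using that(4) 3 by blast
    qed
  qed
qed

lemma first_factor_in_words: "s \<in> states \<Longrightarrow> first_factor s \<in> nonempty_words P"
  by (cases rule: states.cases) (use base_word in auto)

lemma rest_in_states: "s \<in> states \<Longrightarrow> rest s \<in> states"
  by (cases rule: states.cases) (auto intro: states.reservoir)

lemma rewriting_closed:
  "rewriting P u v \<Longrightarrow> a @ u @ b \<in> nonempty_words P \<Longrightarrow> a @ v @ b \<in> nonempty_words P"
  using rewriting_nonempty_words[OF semigroup_presentation] by (auto simp: nonempty_words_iff)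

lemma target_in_states:
  assumes "e \<in> edges L" "source L e \<in> states"
  shows "target L e \<in> states"
proof -
  have "p @ v @ q \<in> states" if "p @ u @ q \<in> states" "(p, u, v, q) \<in> edges L" for p u v q
    using that
  proof (induction "length p" arbitrary: p rule: less_induct)
    case less
    from less.prems(2,1) show ?case
    proof (cases rule: state_edge_cases)
      case (rest a p')
      have "p' @ v @ q \<in> states"
        using less.hyps[of p'] rest by simp
      then show ?thesis using states.block rest by simp
    next
      case (first a b u' v' r)
      then have "a @ v' @ b \<in> nonempty_words P" using rewriting_closed by auto
      from states.block[OF this first(6)] show ?thesis using first by simp
    qed (use base_word states.intros in auto)
  qed
  then show ?thesis using assms by (cases e) auto
qed

text \<open>Two disjoint relation applications that both lie in the first factor, or both behind it, form a
  cell of the respective complex and vanish in the other projection. If one lies in the first factor and the other behind it, each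
  projection of the cell is an edge followed by its inverse. Expansion and contraction of the whole
  word leave no room for a second relation.\<close>

lemma state_cell_null:
  assumes c: "c \<in> boundaries L" and s: "s \<in> states" "is_path L s c s"
  shows "homotopic K (first_factor s) (first_factor s) (concat (map first_edge c)) [] \<and>
    homotopic L (rest s) (rest s) (concat (map rest_edge c)) []"
proof -
  from c obtain p z q l1 r1 l2 r2 where
    cc: "c = [(p, l1, r1, z @ l2 @ q), (p @ r1 @ z, l2, r2, q),
             (p, r1, l1, z @ r2 @ q), (p @ l1 @ z, r2, l2, q)]"
    and rel: "rewriting Q l1 r1" "rewriting Q l2 r2"
    and words: "p \<in> lists (letters Q)" "z \<in> lists (letters Q)" "q \<in> lists (letters Q)"
    by (rule squier_boundary_cases)
  have sw: "s = p @ l1 @ z @ l2 @ q" using s(2) by (simp add: cc)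
  have e1: "(p, l1, r1, z @ l2 @ q) \<in> edges L" "p @ l1 @ (z @ l2 @ q) \<in> states"
    using s by (auto simp: cc sw)
  have e2: "(p @ r1 @ z, l2, r2, q) \<in> edges L" "(p @ r1 @ z) @ l2 @ q \<in> states"
    using s target_in_states[OF e1(1)] by (auto simp: cc sw)
  have trivial: "homotopic K (first_factor s) (first_factor s) [] []"
    "homotopic L (rest s) (rest s) [] []"
    using first_factor_in_words[OF s(1)] states_subset[OF rest_in_states[OF s(1)]]
    by (auto intro: homotopic.refl)
  have nonempty: "r1 \<noteq> []" "l2 \<noteq> []"
    using rel rewriting_nonempty_words[OF semigroup_presentation_power]
    by (auto simp: nonempty_words_iff)
  show ?thesis using e1
  proof (cases rule: state_edge_cases)
    case (rest a p')
    then have "homotopic L (rest s) (rest s) (concat (map rest_edge c)) []"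
      using squier_cell_null[OF semigroup_presentation_power _ words(2,3) rel, of p'] words
      by (simp add: cc sw rest_def)
    moreover have "concat (map first_edge c) = []"
      using rest by (simp add: cc)
    ultimately show ?thesis using trivial by metis
  next
    case (first a b u v r)
    show ?thesis
    proof (cases "closer \<in> set z")
      case True
      then obtain z1 z2 where z: "z = z1 @ closer # z2" "closer \<notin> set z1"
        by (metis split_list_first)
      then have "z1 @ closer # (z2 @ l2 @ q) = map Inl b @ closer # r"
        using first(2) by simp
      then have b: "z1 = map Inl b" "z2 @ l2 @ q = r"
        by (rule first_occurrence_unique; use z in simp)+
      have "is_path K (first_factor s) [(a, u, v, b)] (a @ v @ b)"
        using first rewriting_closed[of u v a b] by (simp add: sw z b first_factor_def)
      from K.homotopic_inv_right[OF this]
      have "homotopic K (first_factor s) (first_factor s) (concat (map first_edge c)) []"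
        using first by (simp add: cc z b)
      moreover have "is_path L (rest s) [(z2, l2, r2, q)] (z2 @ r2 @ q)"
        using first words rel nonempty rewriting_nonempty_words[OF semigroup_presentation_power rel(2)]
          states_subset[OF first(6)]
        by (simp add: sw z b(1) rest_def nonempty_words_iff)
      from L.homotopic_inv_right[OF this]
      have "homotopic L (rest s) (rest s) (concat (map rest_edge c)) []"
        using first by (simp add: cc z b(1))
      ultimately show ?thesis by simp
    next
      case False
      show ?thesis using e2
      proof (cases rule: state_edge_cases)
        case (rest a' p')
        then have "closer \<in> set (p @ r1 @ z)" by simp
        then show ?thesis using False first by simp
      next
        case second: (first a' b' u' v' r')
        obtain z' where z: "z = map Inl z'"
          using first second(1) by (auto simp: append_eq_map_conv map_eq_append_conv)
        have "rewriting P u v" "rewriting P u' v'"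
          "a \<in> lists (letters P)" "z' \<in> lists (letters P)" "b' \<in> lists (letters P)"
          using first second words by (auto simp: z)
        from squier_cell_null[OF semigroup_presentation this(3-5) this(1,2)]
        have "homotopic K (first_factor s) (first_factor s) (concat (map first_edge c)) []"
          by (simp add: cc sw z first second first_factor_def)
        moreover have "concat (map rest_edge c) = []"
          by (simp add: cc z first second)
        ultimately show ?thesis using trivial by metis
      qed (use nonempty in auto)
    qed
  qed (use nonempty in auto)
qed

section \<open>The projections and the inclusions of the two factors\<close>

sublocale first: path_map K L states first_factor "\<lambda>e. first_edge e"
proof
  show "first_factor s \<in> vertices K" if "s \<in> states" for s
    using first_factor_in_words[OF that] by simp
next
  fix e assume e: "e \<in> edges L" "source L e \<in> states"
  then show "target L e \<in> states" by (rule target_in_states)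
  obtain p u v q where puvq: "e = (p, u, v, q)" by (cases e)
  from e have e': "(p, u, v, q) \<in> edges L" "p @ u @ q \<in> states" by (simp_all add: puvq)
  show "is_path K (first_factor (source L e)) (first_edge e) (first_factor (target L e))"
    using e'
  proof (cases rule: state_edge_cases)
    case (rest a p')
    then show ?thesis using puvq by simp
  next
    case (first a b u' v' r)
    have "a @ v' @ b \<in> nonempty_words P" using first rewriting_closed by auto
    then show ?thesis using puvq first by (simp add: first_factor_def)
  qed (use puvq base_word in auto)
  show "first_edge (inv_edge L e) = inv_path K (first_edge e)"
    by (auto simp: puvq)
next
  show "homotopic K (first_factor s) (first_factor s) (concat (map first_edge c)) []"
    if "c \<in> boundaries L" "s \<in> states" "is_path L s c s" for c s
    using state_cell_null[OF that] by simp
qed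

sublocale rest: path_map L L states rest "\<lambda>e. rest_edge e"
proof
  show "rest s \<in> vertices L" if "s \<in> states" for s
    using states_subset[OF rest_in_states[OF that]] by simp
next
  fix e assume e: "e \<in> edges L" "source L e \<in> states"
  then show "target L e \<in> states" by (rule target_in_states)
  obtain p u v q where puvq: "e = (p, u, v, q)" by (cases e)
  from e have e': "(p, u, v, q) \<in> edges L" "p @ u @ q \<in> states" by (simp_all add: puvq)
  show "is_path L (rest (source L e)) (rest_edge e) (rest (target L e))"
    using e'
  proof (cases rule: state_edge_cases)
    case (rest a p')
    have "p' @ v @ q \<in> states"
      using target_in_states[OF rest(4)] rest(3) by simp
    with rest show ?thesis using puvq by (simp add: states_subset)
  next
    case (first a b u' v' r)
    then show ?thesis using puvq by (simp add: rest_def states_subset)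
  qed (use puvq states_subset[OF states.reservoir] in auto)
  show "rest_edge (inv_edge L e) = inv_path L (rest_edge e)"
    by (auto simp: puvq)
next
  show "homotopic L (rest s) (rest s) (concat (map rest_edge c)) []"
    if "c \<in> boundaries L" "s \<in> states" "is_path L s c s" for c s
    using state_cell_null[OF that] by simp
qed

lemma path_map_left:
  assumes r: "r \<in> lists (letters Q)"
  shows "path_map L K (nonempty_words P) (\<lambda>v. block v r) (left_edge r)"
proof
  show "block v r \<in> vertices L" if "v \<in> nonempty_words P" for v
    using that r by (simp add: nonempty_words_iff)
next
  fix e assume e: "e \<in> edges K" "source K e \<in> nonempty_words P"
  obtain p u v q where puvq: "e = (p, u, v, q)" by (cases e)
  have words: "p @ v @ q \<in> nonempty_words P"
    using e rewriting_closed by (auto simp: puvq)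
  then show "target K e \<in> nonempty_words P" by (simp add: puvq)
  show "is_path L (block (source K e) r) (left_edge r e) (block (target K e) r)"
    using e words r by (simp add: puvq nonempty_words_iff rewriting_map_Inl)
  show "left_edge r (inv_edge K e) = inv_path L (left_edge r e)"
    by (simp add: puvq)
next
  fix c s assume c: "c \<in> boundaries K" and s: "s \<in> nonempty_words P" "is_path K s c s"
  from c obtain p z q l1 r1 l2 r2 where
    cc: "c = [(p, l1, r1, z @ l2 @ q), (p @ r1 @ z, l2, r2, q),
             (p, r1, l1, z @ r2 @ q), (p @ l1 @ z, r2, l2, q)]"
    and rel: "rewriting P l1 r1" "rewriting P l2 r2"
    and words: "p \<in> lists (letters P)" "z \<in> lists (letters P)" "q \<in> lists (letters P)"
    by (rule squier_boundary_cases)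
  have sw: "s = p @ l1 @ z @ l2 @ q" using s(2) by (simp add: cc)
  show "homotopic L (block s r) (block s r) (concat (map (left_edge r) c)) []"
    using squier_cell_null[OF semigroup_presentation_power _ _ _ rel[THEN rewriting_map_Inl],
      of "opener # map Inl p" "map Inl z" "map Inl q @ closer # r"] words r
    by (simp add: cc sw)
qed

lemma path_map_right:
  assumes a: "a \<in> lists (letters P)"
  shows "path_map L L (nonempty_words Q) (\<lambda>s. block a s) (right_edge a)"
proof
  show "block a s \<in> vertices L" if "s \<in> nonempty_words Q" for s
    using that a by (simp add: nonempty_words_iff)
next
  fix e assume e: "e \<in> edges L" "source L e \<in> nonempty_words Q"
  then show target: "target L e \<in> nonempty_words Q" using L.target_in_vertices by simp
  obtain p u v q where puvq: "e = (p, u, v, q)" by (cases e)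
  show "is_path L (block a (source L e)) (right_edge a e) (block a (target L e))"
    using e target a by (simp add: puvq nonempty_words_iff)
  show "right_edge a (inv_edge L e) = inv_path L (right_edge a e)"
    by (simp add: puvq)
next
  fix c s assume c: "c \<in> boundaries L" and s: "s \<in> nonempty_words Q" "is_path L s c s"
  from c obtain p z q l1 r1 l2 r2 where
    cc: "c = [(p, l1, r1, z @ l2 @ q), (p @ r1 @ z, l2, r2, q),
             (p, r1, l1, z @ r2 @ q), (p @ l1 @ z, r2, l2, q)]"
    and rel: "rewriting Q l1 r1" "rewriting Q l2 r2"
    and words: "p \<in> lists (letters Q)" "z \<in> lists (letters Q)" "q \<in> lists (letters Q)"
    by (rule squier_boundary_cases)
  have sw: "s = p @ l1 @ z @ l2 @ q" using s(2) by (simp add: cc)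
  show "homotopic L (block a s) (block a s) (concat (map (right_edge a) c)) []"
    using squier_cell_null[OF semigroup_presentation_power _ words(2,3) rel, of "block a p"]
      words(1) a
    by (simp add: cc sw)
qed

abbreviation "first_path es \<equiv> concat (map first_edge es)"
abbreviation "rest_path es \<equiv> concat (map rest_edge es)"
abbreviation "left_path r es \<equiv> concat (map (left_edge r) es)"
abbreviation "right_path a es \<equiv> concat (map (right_edge a) es)"

lemma is_path_left_path:
  assumes "is_path K v as v'" "r \<in> nonempty_words Q"
  shows "is_path L (block v r) (left_path r as) (block v' r)"
  using path_map.path_image[OF path_map_left assms(1)] assms is_path_source[OF assms(1)]
  by (simp add: nonempty_words_iff)

lemma is_path_right_path:
  assumes "is_path L r bs r'" "a \<in> nonempty_words P"
  shows "is_path L (block a r) (right_path a bs) (block a r')"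
  using path_map.path_image[OF path_map_right assms(1)] assms is_path_source[OF assms(1)]
  by (simp add: nonempty_words_iff)

text \<open>The first closing bracket lies between an edge of the first factor and an edge behind it, so
  these are disjoint relation applications and \<open>squier_commute\<close> applies to each pair.\<close>

lemma left_edge_right_path_commute:
  assumes e: "e \<in> edges K" "source K e \<in> nonempty_words P" and bs: "is_path L r bs r'"
  shows "homotopic L (block (source K e) r) (block (target K e) r')
    (left_edge r e @ right_path (target K e) bs) (right_path (source K e) bs @ left_edge r' e)"
  using bs
proof (induction bs arbitrary: r)
  case Nil
  have "is_path K (source K e) [e] (target K e)"
    using e K.target_in_vertices by simp
  from is_path_left_path[OF this] show ?case using Nil by (auto intro: homotopic.refl)
next
  case (Cons b bs)
  let ?s = "source K e" and ?t = "target K e" and ?m = "target L b"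
  obtain p u v q where puvq: "e = (p, u, v, q)" by (cases e)
  obtain p' u' v' q' where b: "b = (p', u', v', q')" by (cases b)
  have t: "?t \<in> nonempty_words P" using e K.target_in_vertices by simp
  have bs: "is_path L ?m bs r'" and b': "is_path L r [b] ?m"
    using Cons.prems by (auto dest: is_path_source)
  have square: "homotopic L (block ?s r) (block ?t ?m)
      (left_edge r e @ right_edge ?t b) (right_edge ?s b @ left_edge ?m e)"
    using squier_commute[OF semigroup_presentation_power, of "opener # map Inl p"
        "map Inl q @ closer # p'" q' "map Inl u" "map Inl v" u' v'] e Cons.prems
    by (auto simp: puvq b rewriting_map_Inl)
  have 1: "homotopic L (block ?s r) (block ?t r')
      ((left_edge r e @ right_edge ?t b) @ right_path ?t bs)
      ((right_edge ?s b @ left_edge ?m e) @ right_path ?t bs)"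
    by (rule homotopic_append[OF square homotopic.refl[OF is_path_right_path[OF bs t]]])
  have 2: "homotopic L (block ?s r) (block ?t r')
      (right_edge ?s b @ (left_edge ?m e @ right_path ?t bs))
      (right_edge ?s b @ (right_path ?s bs @ left_edge r' e))"
    by (rule homotopic_append[OF homotopic.refl Cons.IH[OF bs]])
      (use is_path_right_path[OF b' e(2)] in simp)
  from homotopic.trans[OF 1[unfolded append_assoc] 2] show ?case by simp
qed

lemma left_right_commute:
  assumes as: "is_path K v as v'" and bs: "is_path L r bs r'"
  shows "homotopic L (block v r) (block v' r')
    (left_path r as @ right_path v' bs) (right_path v bs @ left_path r' as)"
  using as
proof (induction as arbitrary: v)
  case Nil
  with is_path_right_path[OF bs, of v] show ?case by (auto intro: homotopic.refl)
next
  case (Cons e es)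
  let ?m = "target K e"
  have e: "e \<in> edges K" "source K e \<in> nonempty_words P" "v = source K e"
    and es: "is_path K ?m es v'" and e': "is_path K v [e] ?m"
    using Cons.prems by (auto dest: is_path_source)
  have r: "r \<in> nonempty_words Q" "r' \<in> nonempty_words Q"
    using is_path_source[OF bs] is_path_target[OF bs] by simp_all
  have 1: "homotopic L (block v r) (block v' r')
      (left_edge r e @ (left_path r es @ right_path v' bs))
      (left_edge r e @ (right_path ?m bs @ left_path r' es))"
    by (rule homotopic_append[OF homotopic.refl Cons.IH[OF es]])
      (use is_path_left_path[OF e' r(1)] in simp)
  have 2: "homotopic L (block v r) (block v' r')
      ((left_edge r e @ right_path ?m bs) @ left_path r' es)
      ((right_path v bs @ left_edge r' e) @ left_path r' es)"
    unfolding e(3)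
    by (rule homotopic_append[OF left_edge_right_path_commute[OF e(1,2) bs]
          homotopic.refl[OF is_path_left_path[OF es r(2)]]])
  from homotopic.trans[OF 1 2[unfolded append_assoc]] show ?case by simp
qed

abbreviation expansion :: "('a + nat) squier_edge" where
  "expansion \<equiv> ([], [reservoir], block w [reservoir], [])"

text \<open>The path from a state to its form as a single block followed by a state.\<close>

definition unroll :: "('a + nat) list \<Rightarrow> ('a + nat) squier_edge list" where
  "unroll s = (if s = [reservoir] then [expansion] else [])"

lemma unroll_simps [simp]: "unroll [reservoir] = [expansion]" "unroll (block v r) = []"
  by (simp_all add: unroll_def)

lemma is_path_expansion: "is_path L [reservoir] [expansion] (block w [reservoir])"
  using base_word by (simp add: nonempty_words_iff rewriting_power_iff)

lemma is_path_unroll: "s \<in> states \<Longrightarrow> is_path L s (unroll s) (block (first_factor s) (rest s))"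
proof (induction rule: states.induct)
  case reservoir
  show ?case using is_path_expansion by simp
next
  case (block v r)
  then show ?case using states_subset[OF states.block] by simp
qed

text \<open>Only a contraction needs a homotopy: it is followed by the expansion that undoes it. In the other
  cases both sides are the same path.\<close>

lemma edge_splits:
  assumes e: "e \<in> edges L" "source L e \<in> states"
  shows "homotopic L (source L e) (block (first_factor (target L e)) (rest (target L e)))
    (e # unroll (target L e))
    (unroll (source L e) @ left_path (rest (source L e)) (first_edge e) @
      right_path (first_factor (target L e)) (rest_edge e))"
proof -
  obtain p u v q where puvq: "e = (p, u, v, q)" by (cases e)
  have t: "target L e \<in> states" by (rule target_in_states[OF e])
  have "is_path L (source L e) (e # unroll (target L e))
      (block (first_factor (target L e)) (rest (target L e)))" (is "is_path L ?s ?es ?t")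
    using e is_path_unroll[OF t] states_subset by simp
  then have refl: "homotopic L ?s ?t ?es ?es" by (rule homotopic.refl)
  from e have e': "(p, u, v, q) \<in> edges L" "p @ u @ q \<in> states" by (simp_all add: puvq)
  then show ?thesis
  proof (cases rule: state_edge_cases)
    case (rest a p')
    then show ?thesis using refl by (simp add: puvq)
  next
    case (first a b u' v' r)
    then show ?thesis using refl by (simp add: puvq rest_def unroll_def)
  next
    case expand
    then show ?thesis using refl by (simp add: puvq)
  next
    case contract
    then show ?thesis
      using L.homotopic_inv_left[OF is_path_expansion] by (simp add: puvq)
  qed
qed

text \<open>Up to homotopy a path is determined by its two projections: once all states are unrolled, its
  edges can be sorted so that those of the first factor precede the others.\<close>

lemma path_splits:
  assumes "is_path L s es t" "s \<in> states"
  shows "homotopic L s (block (first_factor t) (rest t)) (es @ unroll t)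
    (unroll s @ left_path (rest s) (first_path es) @ right_path (first_factor t) (rest_path es))"
  using assms
proof (induction es arbitrary: s)
  case Nil
  then show ?case using is_path_unroll by (auto intro: homotopic.refl)
next
  case (Cons e es)
  let ?m = "target L e"
  have e: "e \<in> edges L" "source L e \<in> states" "s = source L e" and es: "is_path L ?m es t"
    and e': "is_path L s [e] ?m"
    using Cons.prems by (auto dest: is_path_source)
  have m: "?m \<in> states" by (rule target_in_states[OF e(1,2)])
  have t: "t \<in> states" by (rule first.path_closed[OF es m])
  note words = first_factor_in_words[OF m] first_factor_in_words[OF t]
    states_subset[OF rest_in_states[OF Cons.prems(2)]] states_subset[OF rest_in_states[OF m]]
  note first_es = first.path_image[OF es m] and rest_es = rest.path_image[OF es m]
  have first_e: "is_path K (first_factor s) (first_edge e) (first_factor ?m)"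
    and rest_e: "is_path L (rest s) (rest_edge e) (rest ?m)"
    unfolding e(3) by (rule first.edge_image[OF e(1,2)], rule rest.edge_image[OF e(1,2)])
  let ?goal = "\<lambda>xs ys. homotopic L s (block (first_factor t) (rest t)) xs ys"
  let ?l = "left_path (rest s) (first_edge e)" and ?r = "right_path (first_factor ?m) (rest_edge e)"
  let ?l' = "left_path (rest ?m) (first_path es)" and ?r' = "right_path (first_factor t) (rest_path es)"
  have 1: "?goal ([e] @ (es @ unroll t)) ([e] @ (unroll ?m @ ?l' @ ?r'))"
    by (rule homotopic_append[OF homotopic.refl[OF e'] Cons.IH[OF es m]])
  have "is_path L (block (first_factor ?m) (rest ?m)) (?l' @ ?r') (block (first_factor t) (rest t))"
    by (rule is_path_appendI[OF is_path_left_path[OF first_es words(4)]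
          is_path_right_path[OF rest_es words(2)]])
  then have 2: "?goal ((e # unroll ?m) @ (?l' @ ?r')) ((unroll s @ ?l @ ?r) @ (?l' @ ?r'))"
    unfolding e(3) by (rule homotopic_append[OF edge_splits[OF e(1,2)] homotopic.refl])
  have swap: "homotopic L (block (first_factor ?m) (rest s)) (block (first_factor t) (rest ?m))
      (?r @ ?l') (left_path (rest s) (first_path es) @ right_path (first_factor t) (rest_edge e))"
    by (rule homotopic.sym[OF left_right_commute[OF first_es rest_e]])
  have 3: "?goal ((unroll s @ ?l) @ (?r @ ?l') @ ?r')
      ((unroll s @ ?l) @ (left_path (rest s) (first_path es) @
        right_path (first_factor t) (rest_edge e)) @ ?r')"
    by (rule homotopic_extend[OF swap is_path_appendI[OF is_path_unroll[OF Cons.prems(2)]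
            is_path_left_path[OF first_e words(3)]] is_path_right_path[OF rest_es words(2)]])
  from homotopic.trans[OF 1[unfolded append_assoc append_Cons append_Nil]
      homotopic.trans[OF 2[unfolded append_assoc append_Cons append_Nil]
        3[unfolded append_assoc append_Cons append_Nil]]]
  show ?case by simp
qed

section \<open>The isomorphism with the direct power\<close>

primrec factor_path :: "nat \<Rightarrow> ('a + nat) squier_edge list \<Rightarrow> 'a squier_edge list" where
  "factor_path 0 es = first_path es"
| "factor_path (Suc n) es = factor_path n (rest_path es)"

lemma factor_path_append: "factor_path n (as @ bs) = factor_path n as @ factor_path n bs"
  by (induction n arbitrary: as bs) simp_all

lemma length_rest_path_le: "length (rest_path es) \<le> length es"
  by (induction es) (auto split: prod.splits)

text \<open>A path leaving the reservoir starts with the expansion, which both projections forget. This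
  makes \<open>rest_path\<close> a descent: it bounds the number of nontrivial factors and it is the measure of
  the induction that proves injectivity.\<close>

lemma length_rest_path_less:
  assumes "is_path L [reservoir] es t" "es \<noteq> []"
  shows "length (rest_path es) < length es"
proof -
  obtain p u v q es' where es: "es = (p, u, v, q) # es'"
    using assms(2) by (metis list.exhaust prod.exhaust)
  have "p = [] \<or> u = []" using assms(1) by (auto simp: es append_eq_Cons_conv)
  then have "p = []"
    using assms(1) rewriting_nonempty_words[OF semigroup_presentation_power, of u v]
    by (auto simp: es nonempty_words_iff)
  then show ?thesis using length_rest_path_le[of es'] by (simp add: es less_Suc_eq_le)
qed

lemma factor_path_Nil [simp]: "factor_path n [] = []"
  by (induction n) simp_all

lemma factor_path_beyond_length:
  "is_path L [reservoir] es t \<Longrightarrow> length es \<le> n \<Longrightarrow> factor_path n es = []"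
proof (induction n arbitrary: es t)
  case (Suc n)
  show ?case
  proof (cases "es = []")
    case False
    have "is_path L [reservoir] (rest_path es) (rest t)"
      using rest.path_image[OF Suc.prems(1) states.reservoir] by simp
    then show ?thesis
      using Suc.IH length_rest_path_less[OF Suc.prems(1) False] Suc.prems(2)
      by simp
  qed simp
qed simp

lemma factor_path_homotopic:
  assumes "homotopic L [reservoir] [reservoir] as bs"
  shows "homotopic K w w (factor_path n as) (factor_path n bs)"
  using assms
proof (induction n arbitrary: as bs)
  case 0
  from first.homotopic_image[OF this states.reservoir] show ?case by simp
next
  case (Suc n)
  from Suc.IH rest.homotopic_image[OF Suc.prems states.reservoir]
  show ?case by simp
qed

lemma is_path_factor_path:
  "is_path L [reservoir] es [reservoir] \<Longrightarrow> is_path K w (factor_path n es) w"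
  using homotopic_imp_paths[OF factor_path_homotopic[OF homotopic.refl]] by blast

text \<open>By \<open>path_splits\<close> a loop is, up to conjugation by the expansion, the product of a loop in the first
  factor and the loop \<open>rest_path es\<close> behind it. The former is null-homotopic by assumption and the
  latter by induction, since it is shorter and its factors are the remaining factors.\<close>

lemma null_homotopic_of_factors:
  assumes "is_path L [reservoir] es [reservoir]"
    and "\<And>n. homotopic K w w (factor_path n es) []"
  shows "homotopic L [reservoir] [reservoir] es []"
  using assms
proof (induction "length es" arbitrary: es rule: less_induct)
  case less
  show ?case
  proof (cases "es = []")
    case True
    then show ?thesis using less.prems(1) by (auto intro: homotopic.refl)
  next
    case False
    let ?s = "[reservoir]"
    have s: "?s \<in> states" by (rule states.reservoir)
    note s_word = states_subset[OF s]
    have "is_path L ?s (rest_path es) ?s"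
      using rest.path_image[OF less.prems(1) s] by simp
    then have rest: "homotopic L ?s ?s (rest_path es) []"
      using less.hyps[OF length_rest_path_less[OF less.prems(1) False]] less.prems(2)
      by (simp flip: factor_path.simps(2))
    have first: "homotopic K w w (first_path es) []"
      using less.prems(2)[of 0] by simp
    have left: "homotopic L (block w ?s) (block w ?s) (left_path ?s (first_path es)) []"
      using path_map.homotopic_image[OF path_map_left first] s_word base_word
      by (simp add: nonempty_words_iff)
    have right: "homotopic L (block w ?s) (block w ?s) (right_path w (rest_path es)) []"
      using path_map.homotopic_image[OF path_map_right rest] s_word base_word
      by (simp add: nonempty_words_iff)
    have 1: "homotopic L ?s (block w ?s) (es @ [expansion])
        ([expansion] @ left_path ?s (first_path es) @ right_path w (rest_path es))"
      using path_splits[OF less.prems(1) s] by simp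
    have 2: "homotopic L ?s (block w ?s)
        ([expansion] @ left_path ?s (first_path es) @ right_path w (rest_path es))
        ([expansion] @ [] @ [])"
      by (rule homotopic_append[OF homotopic.refl[OF is_path_expansion]
            homotopic_append[OF left right]])
    have "homotopic L ?s (block w ?s) (es @ [expansion]) ([] @ [expansion])"
      using homotopic.trans[OF 1 2] by simp
    then show ?thesis
      by (rule L.homotopic_cancel_right) (use is_path_expansion less.prems(1) s_word in auto)
  qed
qed

text \<open>A loop with prescribed factors: expand, run the first loop in the new block and the others behind
  it, and contract again.\<close>

primrec assemble :: "'a squier_edge list list \<Rightarrow> ('a + nat) squier_edge list" where
  "assemble [] = []"
| "assemble (es # ess) = [expansion] @ left_path [reservoir] es @ right_path w (assemble ess) @
     inv_path L [expansion]"

lemma is_path_assemble: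
  "(\<And>es. es \<in> set ess \<Longrightarrow> is_path K w es w) \<Longrightarrow> is_path L [reservoir] (assemble ess) [reservoir]"
proof (induction ess)
  case Nil
  then show ?case using states_subset[OF states.reservoir] by simp
next
  case (Cons es ess)
  have "is_path L (block w [reservoir]) (left_path [reservoir] es) (block w [reservoir])"
    by (rule is_path_left_path) (use Cons.prems states_subset[OF states.reservoir] in auto)
  moreover have "is_path L (block w [reservoir]) (right_path w (assemble ess)) (block w [reservoir])"
    by (rule is_path_right_path) (use Cons base_word in auto)
  moreover note L.is_path_inv_path[OF is_path_expansion]
  ultimately show ?case
    unfolding assemble.simps using is_path_expansion by (blast intro: is_path_appendI)
qed

lemma first_path_left_path: "first_path (left_path r es) = es"
  by (induction es) (auto split: prod.splits)

lemma rest_path_left_path: "rest_path (left_path r es) = []"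
  by (induction es) (auto split: prod.splits)

lemma first_path_right_path: "first_path (right_path a es) = []"
  by (induction es) (auto split: prod.splits)

lemma rest_path_right_path: "rest_path (right_path a es) = es"
  by (induction es) (auto split: prod.splits)

lemma first_path_assemble: "first_path (assemble (es # ess)) = es"
  using first_path_left_path first_path_right_path by simp

lemma rest_path_assemble: "rest_path (assemble (es # ess)) = assemble ess"
  using rest_path_left_path rest_path_right_path by simp

lemma factor_path_assemble:
  "factor_path n (assemble ess) = (if n < length ess then ess ! n else [])"
proof (induction ess arbitrary: n)
  case (Cons es ess)
  show ?case
    by (cases n) (simp_all only: factor_path.simps first_path_assemble rest_path_assemble Cons.IH
        length_Cons nth_Cons_0 nth_Cons_Suc Suc_less_eq zero_less_Suc if_True)
qed simp

abbreviation "G \<equiv> diagram_group_of P w"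
abbreviation "H \<equiv> diagram_group_of Q [reservoir]"

lemma group_G: "group G"
  unfolding diagram_group_of_def by (rule K.group_fundamental_group) (simp add: base_word)

lemma group_H: "group H"
  unfolding diagram_group_of_def
  by (rule L.group_fundamental_group) (simp add: states_subset[OF states.reservoir])

text \<open>A representative is chosen because a class of loops is a set; \<open>factor_path_homotopic\<close> makes the
  result independent of the choice.\<close>

definition factors :: "('a + nat) squier_edge list set \<Rightarrow> nat \<Rightarrow> 'a squier_edge list set" where
  "factors X = (\<lambda>n. homotopy_class K w (factor_path n (SOME es. es \<in> X)))"

lemma factors_homotopy_class:
  assumes es: "is_path L [reservoir] es [reservoir]"
  shows "factors (homotopy_class L [reservoir] es) = (\<lambda>n. homotopy_class K w (factor_path n es))"
proof -
  have "es \<in> homotopy_class L [reservoir] es"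
    using es by (simp add: in_homotopy_class_iff homotopic.refl)
  then have "(SOME es'. es' \<in> homotopy_class L [reservoir] es) \<in> homotopy_class L [reservoir] es"
    by (rule someI)
  then have hom: "homotopic L [reservoir] [reservoir] es (SOME es'. es' \<in> homotopy_class L [reservoir] es)"
    by (simp add: in_homotopy_class_iff)
  show ?thesis
    unfolding factors_def
    by (rule ext, rule homotopy_class_eqI, rule factor_path_homotopic[OF homotopic.sym[OF hom]])
qed

lemma carrier_countable_direct_power:
  "carrier (countable_direct_power G) =
    {x. (\<forall>n. x n \<in> carrier G) \<and> finite {n. x n \<noteq> \<one>\<^bsub>G\<^esub>}}"
  unfolding countable_direct_power_def
  by (subst carrier_sum_group) (auto simp: group_G PiE_iff)

lemma mult_countable_direct_power:
  "x \<otimes>\<^bsub>countable_direct_power G\<^esub> y = (\<lambda>n. x n \<otimes>\<^bsub>G\<^esub> y n)"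
  by (simp add: countable_direct_power_def restrict_def)

lemma group_countable_direct_power: "group (countable_direct_power G)"
  unfolding countable_direct_power_def by (simp add: group_G)

lemma factors_hom: "group_hom H (countable_direct_power G) factors"
proof (intro group_hom.intro group_hom_axioms.intro group_H group_countable_direct_power homI)
  fix X assume "X \<in> carrier H"
  then obtain es where es: "is_path L [reservoir] es [reservoir]"
    and X: "X = homotopy_class L [reservoir] es"
    unfolding diagram_group_of_def by (rule fundamental_group_cases)
  \<comment> \<open>Each step of \<open>rest_path\<close> shortens the loop, so only finitely many factors are nontrivial.\<close>
  have "n < length es" if "homotopy_class K w (factor_path n es) \<noteq> \<one>\<^bsub>G\<^esub>" for n
    using that factor_path_beyond_length[OF es, of n]
    by (auto simp: diagram_group_of_def one_fundamental_group not_less)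
  then have "{n. homotopy_class K w (factor_path n es) \<noteq> \<one>\<^bsub>G\<^esub>} \<subseteq> {..<length es}"
    by auto
  then have "finite {n. homotopy_class K w (factor_path n es) \<noteq> \<one>\<^bsub>G\<^esub>}"
    by (rule finite_subset) simp
  then show "factors X \<in> carrier (countable_direct_power G)"
    unfolding X factors_homotopy_class[OF es] carrier_countable_direct_power
    using homotopy_class_in_carrier[OF is_path_factor_path[OF es]]
    by (simp add: diagram_group_of_def)
next
  fix X Y assume "X \<in> carrier H" "Y \<in> carrier H"
  then obtain as bs where as: "is_path L [reservoir] as [reservoir]"
    and bs: "is_path L [reservoir] bs [reservoir]"
    and XY: "X = homotopy_class L [reservoir] as" "Y = homotopy_class L [reservoir] bs"
    unfolding diagram_group_of_def by (elim fundamental_group_cases)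
  show "factors (X \<otimes>\<^bsub>H\<^esub> Y) = factors X \<otimes>\<^bsub>countable_direct_power G\<^esub> factors Y"
    unfolding mult_countable_direct_power XY unfolding diagram_group_of_def
    by (simp add: mult_fundamental_group as bs factors_homotopy_class is_path_appendI[OF as bs]
        is_path_factor_path factor_path_append)
qed

lemma factors_iso: "factors \<in> iso H (countable_direct_power G)"
  unfolding group_hom.iso_iff[OF factors_hom]
proof (intro conjI subsetI ballI impI)
  fix x assume "x \<in> carrier (countable_direct_power G)"
  then have x: "x n \<in> carrier G" and fin: "finite {n. x n \<noteq> \<one>\<^bsub>G\<^esub>}" for n
    by (simp_all add: carrier_countable_direct_power)
  have "\<exists>es. is_path K w es w \<and> x n = homotopy_class K w es" for n
    using x[of n] unfolding diagram_group_of_def by (meson fundamental_group_cases)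
  then obtain es where es: "\<And>n. is_path K w (es n) w" "\<And>n. x n = homotopy_class K w (es n)"
    by metis
  obtain N where N: "\<And>n. x n \<noteq> \<one>\<^bsub>G\<^esub> \<Longrightarrow> n < N"
    using finite_nat_bounded[OF fin] by auto
  let ?es = "assemble (map es [0..<N])"
  have path: "is_path L [reservoir] ?es [reservoir]"
    by (rule is_path_assemble) (use es in auto)
  have "homotopy_class K w (factor_path n ?es) = x n" for n
  proof (cases "n < N")
    case True
    then show ?thesis using es by (simp add: factor_path_assemble)
  next
    case False
    then show ?thesis using N[of n]
      by (auto simp: factor_path_assemble diagram_group_of_def one_fundamental_group)
  qed
  then have "x = factors (homotopy_class L [reservoir] ?es)"
    by (simp add: factors_homotopy_class[OF path])
  then show "x \<in> factors ` carrier H"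
    using homotopy_class_in_carrier[OF path] unfolding diagram_group_of_def by blast
next
  fix X assume "X \<in> carrier H" and one: "factors X = \<one>\<^bsub>countable_direct_power G\<^esub>"
  then obtain es where es: "is_path L [reservoir] es [reservoir]"
    and X: "X = homotopy_class L [reservoir] es"
    unfolding diagram_group_of_def by (elim fundamental_group_cases)
  have "homotopy_class K w (factor_path n es) = homotopy_class K w []" for n
    using fun_cong[OF one, of n]
    by (simp add: X factors_homotopy_class[OF es] countable_direct_power_def diagram_group_of_def
        one_fundamental_group)
  then have "homotopic K w w (factor_path n es) []" for n
    using homotopy_class_eq_iff[OF is_path_factor_path[OF es], of "[]" n] base_word by simp
  then have "homotopic L [reservoir] [reservoir] es []"
    by (rule null_homotopic_of_factors[OF es])
  then show "X = \<one>\<^bsub>H\<^esub>"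
    by (simp add: X diagram_group_of_def one_fundamental_group homotopy_class_eqI)
qed

end

theorem theorem9:
  fixes G :: "('g, 'm) monoid_scheme"
  assumes "is_diagram_group TYPE('a) G"
  shows "is_diagram_group TYPE('a + nat) (countable_direct_power G)"
proof -
  obtain P :: "'a presentation" and w where G: "group G"
    and P: "semigroup_presentation P" and w: "w \<in> nonempty_words P"
    and iso: "G \<cong> diagram_group_of P w"
    using assms by (auto simp: is_diagram_group_def)
  interpret pointed_presentation P w
    by unfold_locales (rule P, rule w)
  have "countable_direct_power G \<cong> countable_direct_power (diagram_group_of P w)"
    unfolding countable_direct_power_def by (rule iso_sum_groupI) (use iso G group_G in auto)
  moreover have "countable_direct_power (diagram_group_of P w) \<cong> diagram_group_of Q [reservoir]"
    using group.iso_sym[OF group_H] factors_iso by (auto simp: is_iso_def)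
  ultimately have "countable_direct_power G \<cong> diagram_group_of Q [reservoir]"
    by (rule iso_trans)
  moreover have "group (countable_direct_power G)"
    unfolding countable_direct_power_def using G by simp
  ultimately show ?thesis
    unfolding is_diagram_group_def
    using semigroup_presentation_power states_subset[OF states.reservoir] by blast
qed

end
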